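(* Fix an integer $K\ge1$ and constants $\delta,E_u,E_r,\sigma_r^2,\sigma_d^2>0$, and put $\gamma_r=E_u/\sigma_r^2$, $\gamma_d=E_r/\sigma_d^2$. For $N_d\ge1$ and powers $P_u,P_r>0$ let $$R_k=\frac{1}{2}\log_2\left(1+\frac{\pi N_dP_rP_u}{\sigma_r^2P_r(\pi\delta+4)+4\sigma_d^2\left(KP_u+\sigma_r^2\right)}\right).$$ Let $0\le a\le1$, $P_u=E_u/N_d^{a}$ and $P_r=E_r/N_d^{1-a}$. Then, as $N_d\to\infty$ (with $\delta$ fixed): (1) if $0<a<1$, $R_k\to\frac12\log_2\left(1+\frac{\pi}{4}\gamma_r\gamma_d\right)$; (2) if $a=1$ (so $P_u=E_u/N_d$, $P_r=E_r$), $R_k\to\frac12\log_2\left(1+\frac{\pi}{(\pi\delta+4)\gamma_d+4}\gamma_r\gamma_d\right)$; (3) if $a=0$ (so $P_u=E_u$, $P_r=E_r/N_d$), $R_k\to\frac12\log_2\left(1+\frac{\pi}{4K\gamma_r+4}\gamma_r\gamma_d\right)$.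
   Context: $R_k$ is the closed-form asymptotic rate (rate bound) of each user in a $K$-user massive MIMO relay uplink with $N_d$ base-station antennas, $N_r$ relay antennas, $\delta=N_d/N_r$, per-user power $P_u$, relay power $P_r$, noise variances $\sigma_r^2$ (relay) and $\sigma_d^2$ (base station), and with all path-loss parameters normalized to $1$. *)

theory Defs
  imports Complex_Main
begin

text \<open>
  The path losses are normalized to 1, so the rate is the same for every user \<open>k\<close>.  The parameters
  \<open>\<sigma>r2\<close> and \<open>\<sigma>d2\<close> are the noise variances themselves (already squared).
\<close>

definition rate_bound ::
  "nat \<Rightarrow> real \<Rightarrow> real \<Rightarrow> real \<Rightarrow> nat \<Rightarrow> real \<Rightarrow> real \<Rightarrow> real" where
  "rate_bound K \<delta> \<sigma>r2 \<sigma>d2 Nd Pu Pr =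
     1 / 2 * log 2 (1 + (pi * real Nd * Pr * Pu) /
       (\<sigma>r2 * Pr * (pi * \<delta> + 4) + 4 * \<sigma>d2 * (real K * Pu + \<sigma>r2)))"

definition user_power :: "real \<Rightarrow> real \<Rightarrow> nat \<Rightarrow> real" where
  "user_power Eu a Nd = Eu / real Nd powr a"

definition relay_power :: "real \<Rightarrow> real \<Rightarrow> nat \<Rightarrow> real" where
  "relay_power Er a Nd = Er / real Nd powr (1 - a)"

end

(* The factor Nd in the numerator is exactly used up by the two power scalings,
   Nd * Pu * Pr = Eu * Er, so the rate depends on Nd only through the two powers in the
   denominator, and the three cases differ only in which of these powers vanish in the limit. *)
theory Submission
  imports Defs
begin

text \<open>The exponents \<open>a\<close> and \<open>1 - a\<close> add up to 1, so the two scalings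
  together divide by exactly \<open>Nd\<close>. At \<open>Nd = 0\<close> both powers are 0 by the
  conventions for \<open>powr\<close> and division, hence the bound on \<open>Nd\<close>.\<close>

lemma power_scaling_product:
  assumes "Nd \<ge> 1"
  shows "real Nd * relay_power Er a Nd * user_power Eu a Nd = Er * Eu"
proof -
  have "real Nd powr (1 - a) * real Nd powr a = real Nd"
    using assms by (simp flip: powr_add)
  then show ?thesis
    using assms by (simp add: relay_power_def user_power_def field_simps)
qed

lemma tendsto_const_div_powr_nat:
  fixes c b :: real
  assumes "b > 0"
  shows "(\<lambda>n. c / real n powr b) \<longlonglongrightarrow> 0"
proof -
  have "(\<lambda>n. c * real n powr (- b)) \<longlonglongrightarrow> c * 0"
    using assms by (intro tendsto_mult tendsto_const tendsto_neg_powr filterlim_real_sequentially) auto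
  then show ?thesis
    by (simp add: powr_minus divide_inverse)
qed

text \<open>Once the numerator is constant, the rate is a continuous function of the two powers.
  Their limits \<open>p\<close> and \<open>u\<close> stay as parameters, with 0 allowed, so that all
  three regimes are instances.\<close>

lemma rate_bound_tendsto:
  fixes \<delta> Eu Er \<sigma>r2 \<sigma>d2 a p u :: real
  assumes "\<delta> > 0" "Eu > 0" "Er > 0" "\<sigma>r2 > 0" "\<sigma>d2 > 0" "p \<ge> 0" "u \<ge> 0"
    and p: "relay_power Er a \<longlonglongrightarrow> p"
    and u: "user_power Eu a \<longlonglongrightarrow> u"
  shows "(\<lambda>Nd. rate_bound K \<delta> \<sigma>r2 \<sigma>d2 Nd (user_power Eu a Nd) (relay_power Er a Nd))
    \<longlonglongrightarrow> 1 / 2 * log 2 (1 + pi * Er * Eu /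
      (\<sigma>r2 * p * (pi * \<delta> + 4) + 4 * \<sigma>d2 * (real K * u + \<sigma>r2)))"
proof -
  let ?D = "\<lambda>p u. \<sigma>r2 * p * (pi * \<delta> + 4) + 4 * \<sigma>d2 * (real K * u + \<sigma>r2)"
  have "pi * \<delta> > 0"
    using assms by simp
  then have "\<sigma>r2 * p * (pi * \<delta> + 4) \<ge> 0"
    using assms by (intro mult_nonneg_nonneg) auto
  \<comment> \<open>The noise term \<open>4 * \<sigma>d2 * \<sigma>r2\<close> keeps the limiting
    denominator positive even if both powers vanish.\<close>
  moreover have "4 * \<sigma>d2 * (real K * u + \<sigma>r2) > 0"
    using assms by (intro mult_pos_pos add_nonneg_pos mult_nonneg_nonneg) auto
  ultimately have D: "?D p u > 0"
    by linarith
  then have "pi * Er * Eu / ?D p u > 0"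
    using assms by (intro divide_pos_pos mult_pos_pos) auto
  then have pos: "1 + pi * Er * Eu / ?D p u > 0"
    by linarith
  have "(\<lambda>Nd. 1 / 2 * log 2 (1 + pi * Er * Eu / ?D (relay_power Er a Nd) (user_power Eu a Nd)))
      \<longlonglongrightarrow> 1 / 2 * log 2 (1 + pi * Er * Eu / ?D p u)"
    using D pos by (intro tendsto_intros p u) auto
  \<comment> \<open>The two sides differ at \<open>Nd = 0\<close>, where the rate is 0, so they are
    only identified eventually.\<close>
  moreover have "\<forall>\<^sub>F Nd in sequentially.
      1 / 2 * log 2 (1 + pi * Er * Eu / ?D (relay_power Er a Nd) (user_power Eu a Nd))
      = rate_bound K \<delta> \<sigma>r2 \<sigma>d2 Nd (user_power Eu a Nd) (relay_power Er a Nd)"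
    using eventually_ge_at_top[of 1]
  proof eventually_elim
    case (elim Nd)
    then show ?case
      using power_scaling_product[of Nd Er a Eu] by (simp add: rate_bound_def mult.assoc)
  qed
  ultimately show ?thesis
    by (rule Lim_transform_eventually)
qed

theorem mainTheorem6:
  fixes K :: nat
    and \<delta> Eu Er \<sigma>r2 \<sigma>d2 \<gamma>r \<gamma>d a :: real
    and R :: "nat \<Rightarrow> real"
  assumes "K \<ge> 1"
    and "\<delta> > 0" and "Eu > 0" and "Er > 0" and "\<sigma>r2 > 0" and "\<sigma>d2 > 0"
    and "\<gamma>r = Eu / \<sigma>r2" and "\<gamma>d = Er / \<sigma>d2"
    and "0 \<le> a" and "a \<le> 1"
    and "\<And>Nd. Nd \<ge> 1 \<Longrightarrow>
           R Nd = rate_bound K \<delta> \<sigma>r2 \<sigma>d2 Nd (user_power Eu a Nd) (relay_power Er a Nd)"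
  shows "(0 < a \<and> a < 1 \<longrightarrow>
            R \<longlonglongrightarrow> 1 / 2 * log 2 (1 + pi / 4 * \<gamma>r * \<gamma>d))
       \<and> (a = 1 \<longrightarrow>
            R \<longlonglongrightarrow> 1 / 2 * log 2 (1 + pi / ((pi * \<delta> + 4) * \<gamma>d + 4) * \<gamma>r * \<gamma>d))
       \<and> (a = 0 \<longrightarrow>
            R \<longlonglongrightarrow> 1 / 2 * log 2 (1 + pi / (4 * real K * \<gamma>r + 4) * \<gamma>r * \<gamma>d))"
proof -
  note pos = assms(2-6)
  have R: "R \<longlonglongrightarrow> 1 / 2 * log 2 (1 + pi * Er * Eu /
        (\<sigma>r2 * p * (pi * \<delta> + 4) + 4 * \<sigma>d2 * (real K * u + \<sigma>r2)))"
    if "p \<ge> 0" "u \<ge> 0" "relay_power Er a \<longlonglongrightarrow> p" "user_power Eu a \<longlonglongrightarrow> u" for p u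
    using rate_bound_tendsto[OF pos that]
    by (rule Lim_transform_eventually)
      (use eventually_ge_at_top[of 1] in eventually_elim, simp add: assms(11))
  have relay0: "relay_power Er a \<longlonglongrightarrow> 0" if "a < 1"
    unfolding relay_power_def using that by (intro tendsto_const_div_powr_nat) simp
  have user0: "user_power Eu a \<longlonglongrightarrow> 0" if "0 < a"
    unfolding user_power_def using that by (intro tendsto_const_div_powr_nat)
  \<comment> \<open>For \<open>a = 1\<close> the relay power equals \<open>Er\<close> from
    \<open>Nd = 1\<close> on; at \<open>Nd = 0\<close> it is 0, since \<open>0 powr 0 = 0\<close>.
    The same happens to the user power for \<open>a = 0\<close>.\<close>
  have relay1: "relay_power Er a \<longlonglongrightarrow> Er" if "a = 1"
    by (rule tendsto_eventually)
      (use eventually_ge_at_top[of 1] in eventually_elim, simp add: relay_power_def that)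
  have user1: "user_power Eu a \<longlonglongrightarrow> Eu" if "a = 0"
    by (rule tendsto_eventually)
      (use eventually_ge_at_top[of 1] in eventually_elim, simp add: user_power_def that)
  \<comment> \<open>As \<gamma>r and \<gamma>d contribute
    \<open>Eu * Er / (\<sigma>r2 * \<sigma>d2)\<close>, each claimed limit takes the form in
    \<open>R\<close> once \<open>\<sigma>r2 * \<sigma>d2 * d\<close> is matched with the limiting
    denominator.\<close>
  have cancel: "pi / d * \<gamma>r * \<gamma>d = pi * Er * Eu / (\<sigma>r2 * \<sigma>d2 * d)" for d
    by (simp add: assms(7,8) mult_ac)
  \<comment> \<open>The right-hand side is the limiting denominator at \<open>p = Er\<close>,
    \<open>u = 0\<close>; in \<open>d0\<close> it is the one at \<open>p = 0\<close>,
    \<open>u = Eu\<close>.\<close>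
  have d1: "\<sigma>r2 * \<sigma>d2 * ((pi * \<delta> + 4) * \<gamma>d + 4) = \<sigma>r2 * Er * (pi * \<delta> + 4) + 4 * \<sigma>d2 * \<sigma>r2"
    using pos by (simp add: assms(8) field_simps)
  have d0: "\<sigma>r2 * \<sigma>d2 * (4 * real K * \<gamma>r + 4) = 4 * \<sigma>d2 * (real K * Eu + \<sigma>r2)"
    using pos by (simp add: assms(7) field_simps)
  show ?thesis
  proof (intro conjI impI)
    assume "0 < a \<and> a < 1"
    then show "R \<longlonglongrightarrow> 1 / 2 * log 2 (1 + pi / 4 * \<gamma>r * \<gamma>d)"
      \<comment> \<open>Here \<open>d = 4\<close> and both powers vanish, so only the noise term
        remains in the denominator.\<close>
      using R[OF _ _ relay0 user0] by (simp only: cancel) (simp add: mult_ac)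
  next
    assume "a = 1"
    then show "R \<longlonglongrightarrow> 1 / 2 * log 2 (1 + pi / ((pi * \<delta> + 4) * \<gamma>d + 4) * \<gamma>r * \<gamma>d)"
      using R[OF _ _ relay1 user0] pos by (simp only: cancel d1) simp
  next
    assume "a = 0"
    then show "R \<longlonglongrightarrow> 1 / 2 * log 2 (1 + pi / (4 * real K * \<gamma>r + 4) * \<gamma>r * \<gamma>d)"
      using R[OF _ _ relay0 user1] pos by (simp only: cancel d0) simp
  qed
qed

end
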